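(* Let $m,n$ be positive integers and let $T: M_{m,n}\to M_{m,n}$ be a linear surjective map. Then $T$ is Schur null preserving if and only if there exists a permutation $\rho$ of the set $\{1,2,\ldots,m\}\times\{1,2,\ldots,n\}$ such that $T(a)=T(J_{m,n})\ast a_{\rho}$ for all $a\in M_{m,n}$.
   Context: $M_{m,n}$ is the complex vector space of $m\times n$ complex matrices. For $a=[a_{ij}]$, $b=[b_{ij}]$ in $M_{m,n}$, the Schur product is the entrywise product $a\ast b=[a_{ij}b_{ij}]$. A linear map $T:M_{m,n}\to M_{m,n}$ is Schur null preserving if $T(a)\ast T(b)=0$ whenever $a,b\in M_{m,n}$ satisfy $a\ast b=0$. $J_{m,n}$ is the $m\times n$ matrix all of whose entries are $1$. For a permutation (bijection) $\rho$ of $\{1,\ldots,m\}\times\{1,\ldots,n\}$ and $a=[a_{ij}]\in M_{m,n}$, $a_\rho:=[a_{\rho^{-1}(i,j)}]$, i.e. the $(i,j)$ entry of $a_\rho$ is the entry of $a$ at position $\rho^{-1}(i,j)$. *)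

theory Defs
  imports "HOL-Analysis.Analysis"
begin

text \<open>
  The space of \<open>m \<times> n\<close> complex matrices is \<^typ>\<open>complex^'n^'m\<close>, with arbitrary finite (and nonempty)
  index types \<open>'m\<close> and \<open>'n\<close> in place of \<open>{1,\<dots>,m}\<close> and \<open>{1,\<dots>,n}\<close>. The library has only the real
  scaling \<open>(*\<^sub>R)\<close> on this type, and the class-based \<open>linear\<close> is real-linearity, so the
  complex scaling is introduced here.
\<close>

definition mat_scale :: "complex \<Rightarrow> complex^'n^'m \<Rightarrow> complex^'n^'m"
  where "mat_scale c a = (\<chi> i j. c * a $ i $ j)"

lemma vector_space_mat_scale: "vector_space mat_scale"
  by unfold_locales (simp_all add: mat_scale_def vec_eq_iff algebra_simps)

definition schur_prod ::
    "complex^'n^'m \<Rightarrow> complex^'n^'m \<Rightarrow> complex^'n^'m"  (infixl "\<^bold>*" 70)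
  where "a \<^bold>* b = (\<chi> i j. a $ i $ j * b $ i $ j)"

definition schur_null_preserving :: "(complex^'n^'m \<Rightarrow> complex^'n^'m) \<Rightarrow> bool"
  where "schur_null_preserving T \<longleftrightarrow> (\<forall>a b. a \<^bold>* b = 0 \<longrightarrow> T a \<^bold>* T b = 0)"

definition all_ones :: "complex^'n^'m"
  where "all_ones = (\<chi> i j. 1)"

definition permute_entries :: "('m \<times> 'n \<Rightarrow> 'm \<times> 'n) \<Rightarrow> complex^'n^'m \<Rightarrow> complex^'n^'m"
  where "permute_entries \<rho> a = (\<chi> i j. case inv \<rho> (i, j) of (k, l) \<Rightarrow> a $ k $ l)"

end

theory Submission
  imports Defs
begin

text \<open>
  Write \<open>E q\<close> for the matrix unit at position \<open>q\<close> and \<open>J\<close> for \<open>all_ones\<close>. Matrix units at different positions have Schur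
  product zero, so a Schur null preserving \<open>T\<close> sends them to matrices with disjoint supports: at
  each position \<open>p\<close> at most one \<open>T (E q)\<close> is nonzero. Surjectivity forces at least one to be
  nonzero, because otherwise the \<open>p\<close>-entry of \<open>T a\<close>, which is a combination of the \<open>p\<close>-entries of
  the \<open>T (E q)\<close>, would vanish for all \<open>a\<close>. Calling the unique such position \<open>\<sigma> p\<close>, only one
  term of the expansion survives, and the \<open>p\<close>-entry of \<open>T a\<close> is a nonzero multiple \<open>c p\<close> of the
  \<open>\<sigma> p\<close>-entry of \<open>a\<close>; taking \<open>a = J\<close> identifies \<open>c p\<close> as the \<open>p\<close>-entry of \<open>T J\<close>.

  If \<open>\<sigma>\<close> took the same value at two positions, the corresponding entries of every \<open>T a\<close> would be
  proportional with nonzero factors, and no \<open>T a\<close> could be a matrix unit at one of them. So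
  surjectivity also makes \<open>\<sigma>\<close> injective, hence bijective on the finite set of positions, and
  \<open>\<rho> = inv \<sigma>\<close> is the required permutation. The converse is a computation:
  \<open>T a \<^bold>* T b\<close> is the Schur product of \<open>T J \<^bold>* T J\<close> with the permuted \<open>a \<^bold>* b\<close>.
\<close>

abbreviation entry :: "complex^'n^'m \<Rightarrow> 'm \<times> 'n \<Rightarrow> complex"
  where "entry a p \<equiv> a $ fst p $ snd p"

definition matrix_unit :: "'m \<times> 'n \<Rightarrow> complex^'n^'m"
  where "matrix_unit q = (\<chi> i j. if (i, j) = q then 1 else 0)"

lemma entry_matrix_unit: "entry (matrix_unit q) p = (if p = q then 1 else 0)"
  by (simp add: matrix_unit_def)

lemma matrix_eq_iff_entry: "a = b \<longleftrightarrow> (\<forall>p. entry a p = entry b p)"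
  by (auto simp: vec_eq_iff)

lemma entry_schur_prod: "entry (a \<^bold>* b) p = entry a p * entry b p"
  by (simp add: schur_prod_def)

lemma entry_permute_entries: "entry (permute_entries \<rho> a) p = entry a (inv \<rho> p)"
  by (simp add: permute_entries_def case_prod_beta)

lemma entry_mat_scale: "entry (mat_scale c a) p = c * entry a p"
  by (simp add: mat_scale_def)

lemma entry_sum: "entry (\<Sum>q\<in>A. f q) p = (\<Sum>q\<in>A. entry (f q) p)"
  by simp

lemma matrix_unit_expansion:
  fixes a :: "complex^'n^'m"
  shows "a = (\<Sum>q\<in>UNIV. mat_scale (entry a q) (matrix_unit q))"
  by (simp add: matrix_eq_iff_entry mat_scale_def matrix_unit_def if_distrib
      cong: if_cong)

lemma entry_linear_image:
  fixes T :: "complex^'n^'m \<Rightarrow> complex^'n^'m"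
  assumes "Vector_Spaces.linear mat_scale mat_scale T"
  shows "entry (T a) p = (\<Sum>q\<in>UNIV. entry a q * entry (T (matrix_unit q)) p)"
proof -
  interpret Vector_Spaces.linear mat_scale mat_scale T by fact
  have "T a = (\<Sum>q\<in>UNIV. mat_scale (entry a q) (T (matrix_unit q)))"
    by (subst matrix_unit_expansion[of a]) (simp only: sum scale)
  then show ?thesis
    by (simp only: entry_sum entry_mat_scale)
qed

lemma schur_null_preserving_weighted_permutation:
  fixes T :: "complex^'n^'m \<Rightarrow> complex^'n^'m"
  assumes "\<And>a. T a = w \<^bold>* permute_entries \<rho> a"
  shows "schur_null_preserving T"
  unfolding schur_null_preserving_def
proof (intro allI impI)
  fix a b :: "complex^'n^'m" assume "a \<^bold>* b = 0"
  then have disjoint: "entry a q * entry b q = 0" for q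
    using entry_schur_prod[of a b q] by simp
  have "entry (T a \<^bold>* T b) p = 0" for p
    using disjoint[of "inv \<rho> p"]
    by (auto simp: assms entry_schur_prod entry_permute_entries)
  then show "T a \<^bold>* T b = 0"
    by (simp add: matrix_eq_iff_entry)
qed

text \<open>
  Disjointness of the supports of the images of matrix units gives uniqueness of the source
  position \<open>\<sigma> p\<close>; surjectivity gives its existence and the injectivity of \<open>\<sigma>\<close>.
\<close>

lemma surjective_null_preserving_entries:
  fixes T :: "complex^'n^'m \<Rightarrow> complex^'n^'m"
  assumes lin: "Vector_Spaces.linear mat_scale mat_scale T"
    and "surj T"
    and null: "schur_null_preserving T"
  obtains \<sigma> :: "'m \<times> 'n \<Rightarrow> 'm \<times> 'n" and c
  where "bij \<sigma>" and "\<And>a p. entry (T a) p = entry a (\<sigma> p) * c p"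
proof -
  have "\<exists>q. entry (T (matrix_unit q)) p \<noteq> 0" for p
  proof (rule ccontr)
    assume "\<nexists>q. entry (T (matrix_unit q)) p \<noteq> 0"
    then have "entry (T (matrix_unit q)) p = 0" for q
      by blast
    then have "entry (T a) p = 0" for a
      by (simp only: entry_linear_image[OF lin, of a] mult_zero_right sum.neutral_const)
    then have "entry (matrix_unit p :: complex^'n^'m) p = 0"
      using surjD[OF \<open>surj T\<close>, of "matrix_unit p"] by metis
    then show False
      by (simp add: entry_matrix_unit)
  qed
  then obtain \<sigma> where \<sigma>: "entry (T (matrix_unit (\<sigma> p))) p \<noteq> 0" for p
    by metis
  have unique: "entry (T (matrix_unit q)) p = 0" if "q \<noteq> \<sigma> p" for p q
  proof -
    have "matrix_unit q \<^bold>* matrix_unit (\<sigma> p) = (0 :: complex^'n^'m)"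
      using that by (auto simp: matrix_eq_iff_entry[of _ 0] entry_schur_prod entry_matrix_unit)
    then have "T (matrix_unit q) \<^bold>* T (matrix_unit (\<sigma> p)) = 0"
      using null by (simp add: schur_null_preserving_def)
    then show ?thesis
      using \<sigma>[of p] entry_schur_prod[of "T (matrix_unit q)" "T (matrix_unit (\<sigma> p))" p] by simp
  qed
  define c where "c p = entry (T (matrix_unit (\<sigma> p))) p" for p
  have entries: "entry (T a) p = entry a (\<sigma> p) * c p" for a p
  proof -
    have "entry (T a) p = (\<Sum>q\<in>UNIV. if q = \<sigma> p then entry a (\<sigma> p) * c p else 0)"
      by (subst entry_linear_image[OF lin]) (rule sum.cong, auto simp: c_def unique)
    then show ?thesis by simp
  qed
  have "inj \<sigma>"
  proof (rule injI, rule ccontr)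
    fix p p' assume same: "\<sigma> p = \<sigma> p'" and "p \<noteq> p'"
    obtain a where a: "T a = matrix_unit p"
      using \<open>surj T\<close> by (metis surjD)
    have "entry a (\<sigma> p) * c p = 1" and "entry a (\<sigma> p') * c p' = 0"
      using entries[of a p] entries[of a p'] \<open>p \<noteq> p'\<close> by (simp_all add: a entry_matrix_unit)
    then show False
      using \<sigma>[of p'] same by (auto simp: c_def)
  qed
  then have "bij \<sigma>"
    by (simp add: bij_def finite_UNIV_inj_surj)
  then show ?thesis
    using entries by (rule that)
qed

theorem theorem2p1:
  fixes T :: "complex^'n^'m \<Rightarrow> complex^'n^'m"
  assumes "Vector_Spaces.linear mat_scale mat_scale T"
    and "surj T"
  shows "schur_null_preserving T \<longleftrightarrow>
    (\<exists>\<rho> :: 'm \<times> 'n \<Rightarrow> 'm \<times> 'n. bij \<rho> \<and> (\<forall>a. T a = T all_ones \<^bold>* permute_entries \<rho> a))"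
proof
  assume "schur_null_preserving T"
  with assms obtain \<sigma> c
    where "bij \<sigma>" and entries: "\<And>a p. entry (T a) p = entry a (\<sigma> p) * c p"
    by (rule surjective_null_preserving_entries) (rule that)
  have "T a = T all_ones \<^bold>* permute_entries (inv \<sigma>) a" for a
    by (simp add: matrix_eq_iff_entry[of "T a"] entry_schur_prod entry_permute_entries entries
        inv_inv_eq[OF \<open>bij \<sigma>\<close>]) (simp add: all_ones_def)
  then show "\<exists>\<rho> :: 'm \<times> 'n \<Rightarrow> 'm \<times> 'n. bij \<rho> \<and>
      (\<forall>a. T a = T all_ones \<^bold>* permute_entries \<rho> a)"
    using bij_imp_bij_inv[OF \<open>bij \<sigma>\<close>] by blast
next
  assume "\<exists>\<rho> :: 'm \<times> 'n \<Rightarrow> 'm \<times> 'n. bij \<rho> \<and>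
      (\<forall>a. T a = T all_ones \<^bold>* permute_entries \<rho> a)"
  then obtain \<rho> where "T a = T all_ones \<^bold>* permute_entries \<rho> a" for a
    by blast
  then show "schur_null_preserving T"
    by (rule schur_null_preserving_weighted_permutation)
qed

end
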